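(* Consider solving $Ax=b$ using Anderson acceleration AA(1) applied to the linear fixed-point iteration function $q(x)=Mx+b$ with $M=I-A$. Let $x^*$ satisfy $Ax^*=b$ and let the initial guess be $x_0=x^*+v$, where $v\in\mathbb{R}^n$ is any eigenvector of $A$. Then AA(1) converges to the true solution in at most two iterations, i.e., $x_2=x^*$.
   Context: Setting: $A\in\mathbb{R}^{n\times n}$ is nonsingular, $M=I-A\neq0$, $b\in\mathbb{R}^n$. $\|\cdot\|$ is the 2-norm. The residuals are $r_k=x_k-q(x_k)=Ax_k-b$. AA(1): given $x_0\in\mathbb{R}^n$, set $x_1=q(x_0)$ and for $k\ge1$ $$x_{k+1}=(1+\beta_k)q(x_k)-\beta_kq(x_{k-1}),\qquad \beta_k=\frac{-r_k^T(r_k-r_{k-1})}{\|r_k-r_{k-1}\|^2}\ \text{ if } r_k\ne r_{k-1},$$ and $\beta_k=0$ if $r_k=r_{k-1}$. *)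

theory Defs
  imports "HOL-Analysis.Analysis"
begin

definition eigenvector :: "real ^ 'n ^ 'n \<Rightarrow> real ^ 'n \<Rightarrow> bool" where
  "eigenvector A v \<longleftrightarrow> v \<noteq> 0 \<and> (\<exists>c. A *v v = c *\<^sub>R v)"

definition affine_iteration :: "real ^ 'n ^ 'n \<Rightarrow> real ^ 'n \<Rightarrow> real ^ 'n \<Rightarrow> real ^ 'n" where
  "affine_iteration M b x = M *v x + b"

definition residual :: "('a::real_inner \<Rightarrow> 'a) \<Rightarrow> 'a \<Rightarrow> 'a" where
  "residual q x = x - q x"

(* The first argument is the current residual r_k, the second the previous one r_(k-1). *)
definition aa1_coeff :: "'a::real_inner \<Rightarrow> 'a \<Rightarrow> real" where
  "aa1_coeff r r' = (if r = r' then 0 else - (r \<bullet> (r - r')) / (norm (r - r'))\<^sup>2)"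

fun aa1 :: "('a::real_inner \<Rightarrow> 'a) \<Rightarrow> 'a \<Rightarrow> nat \<Rightarrow> 'a" where
  "aa1 q x0 0 = x0"
| "aa1 q x0 (Suc 0) = q x0"
| "aa1 q x0 (Suc (Suc k)) =
    (let x = aa1 q x0 (Suc k);
         x' = aa1 q x0 k;
         \<beta> = aa1_coeff (residual q x) (residual q x')
     in (1 + \<beta>) *\<^sub>R q x - \<beta> *\<^sub>R q x')"

end

theory Submission
  imports Defs
begin

text \<open>
  For an eigenvector \<open>v\<close> with eigenvalue \<open>c\<close>, the map \<open>q\<close> leaves the line through the solution in
  direction \<open>v\<close> invariant and acts on the coordinate \<open>t\<close> of \<open>xs + t v\<close> as \<open>t \<mapsto> (1 - c) t\<close>, with
  residual \<open>c t v\<close>. On such a line the minimisation that defines the coefficient of AA(1) can bring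
  the extrapolated residual to zero, so the extrapolated
  point is the one given by the secant method for the scalar equation \<open>c t = 0\<close>. This equation is
  linear, so the extrapolated point is the solution itself, which \<open>q\<close> fixes. Nonsingularity of \<open>A\<close> enters through \<open>c \<noteq> 0\<close>: it
  makes the first two residuals different and the secant step well defined.

  Convergence of the whole sequence holds because AA(1) stays at a fixed point once it has reached
  it: a vanishing current residual gives the coefficient zero, so the next step is a plain
  fixed-point step, whatever the previous iterate was.
\<close>

text \<open>The secant coefficient: the norm of the common direction cancels.\<close>

lemma aa1_coeff_parallel:
  assumes "v \<noteq> 0" and "s \<noteq> t"
  shows "aa1_coeff (s *\<^sub>R v) (t *\<^sub>R v) = - s / (s - t)"
proof -
  define d where "d = s - t"
  have "s *\<^sub>R v - t *\<^sub>R v = d *\<^sub>R v"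
    by (simp add: d_def algebra_simps)
  moreover have "norm v \<noteq> 0" "d \<noteq> 0"
    using assms by (auto simp: d_def)
  ultimately have "aa1_coeff (s *\<^sub>R v) (t *\<^sub>R v) = - s / d"
    using assms
    by (simp add: aa1_coeff_def power_mult_distrib dot_square_norm power2_eq_square)
  then show ?thesis
    by (simp add: d_def)
qed

lemma aa1_at_fixed_point_Suc:
  assumes "q xs = xs" and "aa1 q x0 (Suc k) = xs"
  shows "aa1 q x0 (Suc (Suc k)) = xs"
  using assms by (simp add: Let_def residual_def aa1_coeff_def)

lemma aa1_at_fixed_point:
  assumes "q xs = xs" and "aa1 q x0 m = xs" and "1 \<le> m" and "m \<le> n"
  shows "aa1 q x0 n = xs"
  using \<open>m \<le> n\<close>
proof (induction n rule: dec_induct)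
  case (step n)
  then obtain k where "n = Suc k"
    using \<open>1 \<le> m\<close> by (cases n) auto
  with step.IH show ?case
    using aa1_at_fixed_point_Suc[of q xs x0 k] \<open>q xs = xs\<close> by simp
qed (fact assms(2))

text \<open>
  The first two coordinates on the line are \<open>1\<close> and \<open>1 - c\<close>, with residuals \<open>c\<close> and \<open>c (1 - c)\<close>; the
  resulting coefficient \<open>(1 - c) / c\<close> is the one that cancels their images \<open>1 - c\<close> and \<open>(1 - c)\<^sup>2\<close>.
\<close>

lemma aa1_on_invariant_line:
  assumes q: "\<And>t. q (xs + t *\<^sub>R v) = xs + ((1 - c) * t) *\<^sub>R v"
    and "c \<noteq> 0" and "v \<noteq> 0"
  shows "aa1 q (xs + v) 2 = xs"
proof -
  have res: "residual q (xs + t *\<^sub>R v) = (c * t) *\<^sub>R v" for t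
    by (simp add: residual_def q algebra_simps)
  have q0: "q (xs + v) = xs + (1 - c) *\<^sub>R v"
    using q[of 1] by simp
  have "residual q (xs + v) = c *\<^sub>R v"
    using res[of 1] by simp
  moreover have "c * (1 - c) \<noteq> c"
    using \<open>c \<noteq> 0\<close> by simp
  moreover have "- (c * (1 - c)) / (c * (1 - c) - c) = (1 - c) / c"
    using \<open>c \<noteq> 0\<close> by (simp add: field_simps)
  ultimately have \<beta>: "aa1_coeff (residual q (q (xs + v))) (residual q (xs + v)) = (1 - c) / c"
    using aa1_coeff_parallel[OF \<open>v \<noteq> 0\<close>, of "c * (1 - c)" c] by (simp add: q0 res)
  have combination: "(1 + \<gamma>) *\<^sub>R (xs + a *\<^sub>R v) - \<gamma> *\<^sub>R (xs + b *\<^sub>R v) = xs + ((1 + \<gamma>) * a - \<gamma> * b) *\<^sub>R v"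
    for \<gamma> a b :: real
    by (simp add: algebra_simps)
  have "aa1 q (xs + v) 2 = (1 + (1 - c) / c) *\<^sub>R q (q (xs + v)) - ((1 - c) / c) *\<^sub>R q (xs + v)"
    using \<beta> by (simp add: numeral_2_eq_2 Let_def)
  also have "\<dots> = xs + ((1 + (1 - c) / c) * ((1 - c) * (1 - c)) - (1 - c) / c * (1 - c)) *\<^sub>R v"
    unfolding q0 q by (rule combination)
  also have "(1 + (1 - c) / c) * ((1 - c) * (1 - c)) - (1 - c) / c * (1 - c) = 0"
    using \<open>c \<noteq> 0\<close> by (simp add: field_simps)
  finally show ?thesis
    by simp
qed

lemma eigenvalue_nonzero:
  fixes A :: "real ^ 'n ^ 'n"
  assumes "invertible A" and "v \<noteq> 0" and "A *v v = c *\<^sub>R v"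
  shows "c \<noteq> 0"
proof
  assume "c = 0"
  then have "A *v v = A *v 0"
    using assms(3) by simp
  then show False
    using inj_matrix_vector_mult[OF assms(1)] \<open>v \<noteq> 0\<close> by (metis injD)
qed

theorem proposition3p11:
  fixes A M :: "real ^ 'n ^ 'n"
    and b xs v x0 :: "real ^ 'n"
    and q :: "real ^ 'n \<Rightarrow> real ^ 'n"
  assumes "invertible A"
    and "M = mat 1 - A"
    and "M \<noteq> 0"
    and "q = affine_iteration M b"
    and "A *v xs = b"
    and "eigenvector A v"
    and "x0 = xs + v"
  shows "aa1 q x0 \<longlonglongrightarrow> xs \<and> aa1 q x0 2 = xs"
proof -
  obtain c where v: "v \<noteq> 0" "A *v v = c *\<^sub>R v"
    using assms(6) by (auto simp: eigenvector_def)
  have q: "q (xs + t *\<^sub>R v) = xs + ((1 - c) * t) *\<^sub>R v" for t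
    unfolding assms(2,4) affine_iteration_def assms(5)[symmetric]
    by (simp add: matrix_vector_mult_diff_rdistrib matrix_vector_right_distrib
        matrix_vector_mult_scaleR v(2)) (simp add: algebra_simps)
  have two: "aa1 q x0 2 = xs"
    using aa1_on_invariant_line[OF q eigenvalue_nonzero[OF assms(1) v] v(1)] assms(7) by simp
  have "q xs = xs"
    using q[of 0] by simp
  then have "aa1 q x0 n = xs" if "2 \<le> n" for n
    using aa1_at_fixed_point[OF _ two _ that] by simp
  then have "aa1 q x0 \<longlonglongrightarrow> xs"
    by (intro tendsto_eventually) (auto simp: eventually_sequentially)
  with two show ?thesis
    by blast
qed

end
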